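(* Let $\alpha_R,\alpha_F\in[0,1)$, let $T_{\rm D}:\mathbb{R}\rightrightarrows\mathbb{R}$ be monotone and outer semicontinuous, and let $T_{\rm NPN}:\mathbb{R}^2\rightrightarrows\mathbb{R}^2$ be the Ebers--Moll transistor operator $$T_{\rm NPN}\begin{pmatrix} v_1 \\ v_2 \end{pmatrix}=\left\{\begin{pmatrix} 1 & -\alpha_R \\ -\alpha_F & 1 \end{pmatrix}\begin{pmatrix} u_1 \\ u_2 \end{pmatrix}: u_1\in T_{\rm D}(v_1),\ u_2\in T_{\rm D}(v_2)\right\}.$$ Then $T_{\rm NPN}$ is $\left(\frac{1}{8\rho},\rho\right)$-semimonotone for all $\rho<0$.
   Context: For a set-valued operator $A:\mathbb{R}^n\rightrightarrows\mathbb{R}^n$, its graph is $\operatorname{gph}A=\{(x,u): u\in A(x)\}$. $A$ is outer semicontinuous if $\operatorname{gph}A$ is closed, and monotone if $\langle x-y,u-v\rangle\ge0$ for all $(x,u),(y,v)\in\operatorname{gph}A$. For $\mu,\rho\in\mathbb{R}$, $A$ is $(\mu,\rho)$-semimonotone if $\langle x-y,u-v\rangle\ge\mu\|x-y\|^2+\rho\|u-v\|^2$ for all $(x,u),(y,v)\in\operatorname{gph}A$ (Euclidean inner product and norm). *)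

theory Defs
  imports "HOL-Analysis.Analysis"
begin

(* Set-valued operators on R^n are functions 'a => 'a set over a Euclidean space 'a, so that
   both real and real^2 are instances; inner and norm are then the Euclidean ones. *)

definition gph :: "('a \<Rightarrow> 'b set) \<Rightarrow> ('a \<times> 'b) set" where
  "gph A = {(x, u). u \<in> A x}"

definition outer_semicontinuous :: "('a::euclidean_space \<Rightarrow> 'a set) \<Rightarrow> bool" where
  "outer_semicontinuous A \<longleftrightarrow> closed (gph A)"

definition monotone_operator :: "('a::euclidean_space \<Rightarrow> 'a set) \<Rightarrow> bool" where
  "monotone_operator A \<longleftrightarrow>
    (\<forall>(x, u) \<in> gph A. \<forall>(y, v) \<in> gph A. (x - y) \<bullet> (u - v) \<ge> 0)"

definition semimonotone :: "real \<Rightarrow> real \<Rightarrow> ('a::euclidean_space \<Rightarrow> 'a set) \<Rightarrow> bool" where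
  "semimonotone \<mu> \<rho> A \<longleftrightarrow>
    (\<forall>(x, u) \<in> gph A. \<forall>(y, v) \<in> gph A.
      (x - y) \<bullet> (u - v) \<ge> \<mu> * (norm (x - y))\<^sup>2 + \<rho> * (norm (u - v))\<^sup>2)"

definition T_NPN :: "real \<Rightarrow> real \<Rightarrow> (real \<Rightarrow> real set) \<Rightarrow> real^2 \<Rightarrow> (real^2) set" where
  "T_NPN \<alpha>\<^sub>R \<alpha>\<^sub>F T\<^sub>D v =
    {(vector [vector [1, - \<alpha>\<^sub>R], vector [- \<alpha>\<^sub>F, 1]] :: real^2^2) *v vector [u1, u2] | u1 u2.
      u1 \<in> T\<^sub>D (v $ 1) \<and> u2 \<in> T\<^sub>D (v $ 2)}"

end

theory Submission
  imports Defs
begin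

text \<open>
  Take two points of the graph and let \<open>(a, b)\<close> be the difference of their voltages, \<open>(p, q)\<close> the
  difference of the diode currents, and \<open>w = (p - \<alpha>\<^sub>R q, q - \<alpha>\<^sub>F p)\<close> that of the terminal currents.
  Monotonicity of the diode says \<open>a p \<ge> 0\<close> and \<open>b q \<ge> 0\<close>. With \<open>r = - \<rho> > 0\<close> the claim is
  \<open>a w\<^sub>1 + b w\<^sub>2 + (a\<^sup>2 + b\<^sup>2) / (8 r) + r (w\<^sub>1\<^sup>2 + w\<^sub>2\<^sup>2) \<ge> 0\<close>.

  Only negative products \<open>a w\<^sub>1\<close>, \<open>b w\<^sub>2\<close> can hurt. If \<open>a w\<^sub>1 < 0\<close>, then at port 1 the current fed
  back from port 2 overwhelms the diode's own current. As the gains \<open>\<alpha>\<^sub>R\<close> and \<open>\<alpha>\<^sub>F\<close> are at most 1,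
  the current at port 2 must then be the larger one, so that \<open>b w\<^sub>2 \<ge> 0\<close> and \<open>\<bar>w\<^sub>1\<bar> \<le> \<bar>w\<^sub>2\<bar>\<close>
  (\<open>active_port_dominated\<close>). The sole negative term is then absorbed, because
  \<open>r (w\<^sub>1\<^sup>2 + w\<^sub>2\<^sup>2) \<ge> 2 r w\<^sub>1\<^sup>2\<close>, and \<open>a w\<^sub>1 + a\<^sup>2 / (8 r) + 2 r w\<^sub>1\<^sup>2\<close> is the square
  \<open>(a + 4 r w\<^sub>1)\<^sup>2 / (8 r)\<close>. This doubling is where the constant 8, rather than 4, comes from.
  The case \<open>b w\<^sub>2 < 0\<close> is symmetric.
\<close>

text \<open>
  For \<open>a > 0\<close> the hypotheses force \<open>0 \<le> p < R q \<le> q\<close>, hence \<open>b \<ge> 0\<close> and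
  \<open>0 < R q - p \<le> q - p \<le> q - F p\<close>; \<open>a < 0\<close> reduces to this by negating all differences.
\<close>

lemma active_port_dominated:
  fixes R F a b p q :: real
  assumes R: "0 \<le> R" "R \<le> 1" and F: "0 \<le> F" "F \<le> 1"
    and "0 \<le> a * p" and "0 \<le> b * q" and "a * (p - R * q) < 0"
  shows "0 \<le> b * (q - F * p)" and "\<bar>p - R * q\<bar> \<le> \<bar>q - F * p\<bar>"
proof -
  have pos: "0 \<le> b * (q - F * p) \<and> \<bar>p - R * q\<bar> \<le> \<bar>q - F * p\<bar>"
    if "0 < a" "0 \<le> a * p" "0 \<le> b * q" "a * (p - R * q) < 0" for a b p q :: real
  proof -
    have p: "0 \<le> p" using that(1,2) by (simp add: zero_le_mult_iff)
    have pq: "p < R * q" using that(1,4) by (simp add: mult_less_0_iff)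
    have q: "0 < q" using p pq R by (smt (verit) mult_nonneg_nonpos)
    have b: "0 \<le> b" using that(3) q by (simp add: zero_le_mult_iff)
    have Rq: "R * q \<le> q" using R q by (simp add: mult_left_le_one_le)
    have Fp: "F * p \<le> p" using F p by (simp add: mult_left_le_one_le)
    show ?thesis
      using b p pq Rq Fp by (auto intro: mult_nonneg_nonneg)
  qed
  have "0 < a \<or> 0 < - a"
    using assms(7) by (auto simp: mult_less_0_iff)
  then have "0 \<le> b * (q - F * p) \<and> \<bar>p - R * q\<bar> \<le> \<bar>q - F * p\<bar>"
  proof
    assume "0 < a"
    then show ?thesis using pos assms(5-7) by blast
  next
    assume "0 < - a"
    then show ?thesis
      using pos[of "- a" "- p" "- b" "- q"] assms(5-7) by (simp add: algebra_simps abs_if split: if_splits)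
  qed
  then show "0 \<le> b * (q - F * p)" and "\<bar>p - R * q\<bar> \<le> \<bar>q - F * p\<bar>" by auto
qed

text \<open>
  One possibly negative product is absorbed by completing the square, once the second output
  coordinate contributes a further \<open>r w\<^sup>2\<close>.
\<close>

lemma dominated_product_absorbed:
  fixes r a b w z :: real
  assumes r: "0 < r" and "0 \<le> b * z" and "\<bar>w\<bar> \<le> \<bar>z\<bar>"
  shows "0 \<le> a * w + b * z + (a\<^sup>2 + b\<^sup>2) / (8 * r) + r * (w\<^sup>2 + z\<^sup>2)"
proof -
  have "w\<^sup>2 \<le> z\<^sup>2" using assms(3) by (simp add: abs_le_square_iff)
  then have wz: "r * (2 * w\<^sup>2) \<le> r * (w\<^sup>2 + z\<^sup>2)" using r by (intro mult_left_mono) auto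
  have "a * w + a\<^sup>2 / (8 * r) + r * (2 * w\<^sup>2) = (a + 4 * r * w)\<^sup>2 / (8 * r)"
    using r by (simp add: field_simps power2_eq_square)
  then have "0 \<le> a * w + a\<^sup>2 / (8 * r) + r * (2 * w\<^sup>2)" using r by simp
  moreover have "0 \<le> b\<^sup>2 / (8 * r)" using r by simp
  ultimately show ?thesis using wz assms(2) by (simp add: add_divide_distrib)
qed

lemma transistor_quadratic_form_nonneg:
  fixes R F a b p q r :: real
  assumes R: "0 \<le> R" "R \<le> 1" and F: "0 \<le> F" "F \<le> 1"
    and ap: "0 \<le> a * p" and bq: "0 \<le> b * q" and r: "0 < r"
  shows "0 \<le> a * (p - R * q) + b * (q - F * p) + (a\<^sup>2 + b\<^sup>2) / (8 * r)
              + r * ((p - R * q)\<^sup>2 + (q - F * p)\<^sup>2)"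
proof -
  consider "a * (p - R * q) < 0" | "b * (q - F * p) < 0"
    | "0 \<le> a * (p - R * q)" "0 \<le> b * (q - F * p)" by linarith
  then show ?thesis
  proof cases
    case 1
    from active_port_dominated[OF R F ap bq 1] show ?thesis
      by (intro dominated_product_absorbed r)
  next
    case 2
    from dominated_product_absorbed[OF r active_port_dominated[OF F R bq ap 2], of b]
    show ?thesis by (simp add: algebra_simps)
  next
    case 3
    then show ?thesis using r by simp
  qed
qed

theorem corollary2:
  fixes \<alpha>\<^sub>R \<alpha>\<^sub>F :: real and T\<^sub>D :: "real \<Rightarrow> real set"
  assumes "\<alpha>\<^sub>R \<in> {0..<1}" and "\<alpha>\<^sub>F \<in> {0..<1}"
    and "monotone_operator T\<^sub>D" and "outer_semicontinuous T\<^sub>D"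
  shows "\<forall>\<rho><0. semimonotone (1 / (8 * \<rho>)) \<rho> (T_NPN \<alpha>\<^sub>R \<alpha>\<^sub>F T\<^sub>D)"
proof -
  have mono: "0 \<le> (s - t) * (g - h)" if "g \<in> T\<^sub>D s" "h \<in> T\<^sub>D t" for s t g h
    using assms(3) that unfolding monotone_operator_def gph_def by auto
  have "1 / (8 * \<rho>) * (norm (x - y))\<^sup>2 + \<rho> * (norm (u - v))\<^sup>2 \<le> (x - y) \<bullet> (u - v)"
    if \<rho>: "\<rho> < 0" and u: "u \<in> T_NPN \<alpha>\<^sub>R \<alpha>\<^sub>F T\<^sub>D x" and v: "v \<in> T_NPN \<alpha>\<^sub>R \<alpha>\<^sub>F T\<^sub>D y"
    for \<rho> x y u v
  proof -
    from u obtain u1 u2 where u12: "u1 \<in> T\<^sub>D (x $ 1)" "u2 \<in> T\<^sub>D (x $ 2)"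
      and ueq: "u $ 1 = u1 - \<alpha>\<^sub>R * u2" "u $ 2 = u2 - \<alpha>\<^sub>F * u1"
      by (auto simp: T_NPN_def matrix_vector_mult_def sum_2)
    from v obtain v1 v2 where v12: "v1 \<in> T\<^sub>D (y $ 1)" "v2 \<in> T\<^sub>D (y $ 2)"
      and veq: "v $ 1 = v1 - \<alpha>\<^sub>R * v2" "v $ 2 = v2 - \<alpha>\<^sub>F * v1"
      by (auto simp: T_NPN_def matrix_vector_mult_def sum_2)
    define a b p q where "a = x $ 1 - y $ 1" and "b = x $ 2 - y $ 2"
      and "p = u1 - v1" and "q = u2 - v2"
    have w: "u $ 1 - v $ 1 = p - \<alpha>\<^sub>R * q" "u $ 2 - v $ 2 = q - \<alpha>\<^sub>F * p"
      by (simp_all add: ueq veq p_def q_def algebra_simps)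
    have ip: "(x - y) \<bullet> (u - v) = a * (p - \<alpha>\<^sub>R * q) + b * (q - \<alpha>\<^sub>F * p)"
      by (simp add: inner_vec_def sum_2 w a_def b_def)
    have nx: "(norm (x - y))\<^sup>2 = a\<^sup>2 + b\<^sup>2"
      by (simp only: power2_norm_eq_inner) (simp add: inner_vec_def sum_2 a_def b_def power2_eq_square)
    have nu: "(norm (u - v))\<^sup>2 = (p - \<alpha>\<^sub>R * q)\<^sup>2 + (q - \<alpha>\<^sub>F * p)\<^sup>2"
      by (simp only: power2_norm_eq_inner) (simp add: inner_vec_def sum_2 w power2_eq_square)
    have "0 \<le> a * p" "0 \<le> b * q"
      unfolding a_def b_def p_def q_def using mono u12 v12 by auto
    then have "0 \<le> a * (p - \<alpha>\<^sub>R * q) + b * (q - \<alpha>\<^sub>F * p) + (a\<^sup>2 + b\<^sup>2) / (8 * - \<rho>)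
                  + - \<rho> * ((p - \<alpha>\<^sub>R * q)\<^sup>2 + (q - \<alpha>\<^sub>F * p)\<^sup>2)"
      using assms(1,2) \<rho> by (intro transistor_quadratic_form_nonneg) auto
    then show ?thesis
      unfolding ip nx nu by simp
  qed
  then show ?thesis
    by (auto simp: semimonotone_def gph_def)
qed

end
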